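(* A game is point-symmetric if and only if it is isomorphic to a coset space game.
   Context: A tournament on a finite set $I$ is a relation $\Pi\subset I\times I$ without loops such that for distinct $i,j$ exactly one of $(i,j),(j,i)$ is in $\Pi$; a game is a tournament on a set of odd size $2n+1$ in which every vertex has $n$ outputs and $n$ inputs. An isomorphism of tournaments is a bijection $\rho$ of vertex sets with $(i,j)\in\Pi\Leftrightarrow(\rho(i),\rho(j))\in\Gamma$. A game on $I$ is point-symmetric when its automorphism group acts transitively on $I$. For a finite group $G$ of odd order with identity $e$, a game subset is $A\subset G$ such that $G$ is the disjoint union $A\cup A^{-1}\cup\{e\}$. For a subgroup $H$ of $G$, $A$ is a game subset for $(G,H)$ if it is a game subset of $G$ and $i\in A\setminus H$ implies $HiH\subset A$. A coset space game is a game of the form $\Gamma[A/H]=\{(iH,jH):i^{-1}jH\in A/H\}$ on the set $G/H$ of left cosets, where $G$ is a finite group of odd order, $H$ is a subgroup, $A$ is a game subset for $(G,H)$ and $A/H=\{iH:iH\subset A\}$. *)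

theory Defs
  imports "HOL-Algebra.Group_Action" "HOL-Algebra.Left_Coset"
begin

section \<open>Tournaments and games\<close>

definition tournament :: "'a set \<Rightarrow> ('a \<times> 'a) set \<Rightarrow> bool" where
  "tournament I P \<longleftrightarrow>
     finite I \<and> P \<subseteq> I \<times> I \<and> (\<forall>i\<in>I. (i, i) \<notin> P) \<and>
     (\<forall>i\<in>I. \<forall>j\<in>I. i \<noteq> j \<longrightarrow> ((i, j) \<in> P \<longleftrightarrow> (j, i) \<notin> P))"

text \<open>The case \<open>n = 0\<close>, the empty relation on a single vertex, counts as a game.\<close>

definition game :: "'a set \<Rightarrow> ('a \<times> 'a) set \<Rightarrow> bool" where
  "game I P \<longleftrightarrow> tournament I P \<and>
     (\<exists>n. card I = 2 * n + 1 \<and>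
        (\<forall>i\<in>I. card {j. (i, j) \<in> P} = n \<and> card {j. (j, i) \<in> P} = n))"

definition tournament_isomorphism ::
    "'a set \<Rightarrow> ('a \<times> 'a) set \<Rightarrow> 'b set \<Rightarrow> ('b \<times> 'b) set \<Rightarrow> ('a \<Rightarrow> 'b) \<Rightarrow> bool" where
  "tournament_isomorphism I P J \<Gamma> \<rho> \<longleftrightarrow>
     bij_betw \<rho> I J \<and> (\<forall>i\<in>I. \<forall>j\<in>I. (i, j) \<in> P \<longleftrightarrow> (\<rho> i, \<rho> j) \<in> \<Gamma>)"

definition tournament_isomorphic ::
    "'a set \<Rightarrow> ('a \<times> 'a) set \<Rightarrow> 'b set \<Rightarrow> ('b \<times> 'b) set \<Rightarrow> bool" where
  "tournament_isomorphic I P J \<Gamma> \<longleftrightarrow> (\<exists>\<rho>. tournament_isomorphism I P J \<Gamma> \<rho>)"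

section \<open>Point-symmetric games\<close>

text \<open>As in \<^const>\<open>BijGroup\<close>, automorphisms are taken extensional on \<open>I\<close>, so that each
  automorphism of the vertex set is represented by exactly one function.\<close>

definition automorphism_group :: "'a set \<Rightarrow> ('a \<times> 'a) set \<Rightarrow> ('a \<Rightarrow> 'a) monoid" where
  "automorphism_group I P =
     BijGroup I\<lparr>carrier := {\<rho> \<in> extensional I. tournament_isomorphism I P I P \<rho>}\<rparr>"

definition point_symmetric :: "'a set \<Rightarrow> ('a \<times> 'a) set \<Rightarrow> bool" where
  "point_symmetric I P \<longleftrightarrow> transitive_action (automorphism_group I P) I (\<lambda>\<rho>. \<rho>)"

text \<open>The automorphisms always form a group acting on the vertices, so only the transitivity
  clause of \<^locale>\<open>transitive_action\<close> is a condition on the game.\<close>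

lemma subgroup_automorphisms:
  "subgroup {\<rho> \<in> extensional I. tournament_isomorphism I P I P \<rho>} (BijGroup I)"
    (is "subgroup ?A _")
proof -
  interpret B: group "BijGroup I" by (rule group_BijGroup)
  have sub: "?A \<subseteq> Bij I"
    by (auto simp: Bij_def tournament_isomorphism_def)
  show ?thesis
  proof (rule B.subgroupI)
    show "?A \<subseteq> carrier (BijGroup I)"
      using sub by (simp add: BijGroup_def)
    have "(\<lambda>x\<in>I. x) \<in> ?A"
      by (auto simp: tournament_isomorphism_def bij_betw_def inj_on_def)
    then show "?A \<noteq> {}" by blast
  next
    fix f assume f: "f \<in> ?A"
    then have fB: "f \<in> Bij I" and bij: "bij_betw f I I" using sub
      by (auto simp: tournament_isomorphism_def)
    have "(i, j) \<in> P \<longleftrightarrow> (inv_into I f i, inv_into I f j) \<in> P" if "i \<in> I" "j \<in> I" for i j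
    proof -
      have "inv_into I f i \<in> I" "inv_into I f j \<in> I"
        using that fB by (auto intro: Bij_inv_into_mem)
      moreover have "f (inv_into I f i) = i" "f (inv_into I f j) = j"
        using that bij by (auto simp: bij_betw_inv_into_right)
      ultimately show ?thesis using f by (auto simp: tournament_isomorphism_def)
    qed
    then have "restrict (inv_into I f) I \<in> ?A"
      using bij by (auto simp: tournament_isomorphism_def bij_betw_inv_into)
    then show "inv\<^bsub>BijGroup I\<^esub> f \<in> ?A"
      using fB by (simp add: inv_BijGroup)
  next
    fix f g assume fg: "f \<in> ?A" "g \<in> ?A"
    then have B: "f \<in> Bij I" "g \<in> Bij I" using sub by auto
    have g: "g i \<in> I" if "i \<in> I" for i
      using that B Bij_imp_funcset by blast
    have "compose I f g \<in> ?A"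
      using fg g compose_Bij[OF B]
      by (auto simp: tournament_isomorphism_def Bij_def compose_eq)
    then show "f \<otimes>\<^bsub>BijGroup I\<^esub> g \<in> ?A"
      using B by (simp add: BijGroup_def)
  qed
qed

lemma group_action_automorphism_group:
  "group_action (automorphism_group I P) I (\<lambda>\<rho>. \<rho>)"
  unfolding automorphism_group_def group_action_def group_hom_def group_hom_axioms_def
  using subgroup_automorphisms[of I P] group_BijGroup[of I]
  by (auto simp: hom_def subgroup.subgroup_is_group dest: subgroup.subset)

section \<open>Coset space games\<close>

definition game_subset :: "('g, 'm) monoid_scheme \<Rightarrow> 'g set \<Rightarrow> bool" where
  "game_subset G A \<longleftrightarrow>
     carrier G = A \<union> set_inv\<^bsub>G\<^esub> A \<union> {\<one>\<^bsub>G\<^esub>} \<and>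
     A \<inter> set_inv\<^bsub>G\<^esub> A = {} \<and> \<one>\<^bsub>G\<^esub> \<notin> A \<and> \<one>\<^bsub>G\<^esub> \<notin> set_inv\<^bsub>G\<^esub> A"

definition game_subset_for :: "('g, 'm) monoid_scheme \<Rightarrow> 'g set \<Rightarrow> 'g set \<Rightarrow> bool" where
  "game_subset_for G H A \<longleftrightarrow>
     game_subset G A \<and> (\<forall>i \<in> A - H. H <#>\<^bsub>G\<^esub> (i <#\<^bsub>G\<^esub> H) \<subseteq> A)"

definition cosets_within :: "('g, 'm) monoid_scheme \<Rightarrow> 'g set \<Rightarrow> 'g set \<Rightarrow> 'g set set" where
  "cosets_within G H A = {i <#\<^bsub>G\<^esub> H | i. i \<in> carrier G \<and> i <#\<^bsub>G\<^esub> H \<subseteq> A}"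

definition coset_space_relation ::
    "('g, 'm) monoid_scheme \<Rightarrow> 'g set \<Rightarrow> 'g set \<Rightarrow> ('g set \<times> 'g set) set" where
  "coset_space_relation G H A =
     {(i <#\<^bsub>G\<^esub> H, j <#\<^bsub>G\<^esub> H) | i j. i \<in> carrier G \<and> j \<in> carrier G \<and>
        (inv\<^bsub>G\<^esub> i \<otimes>\<^bsub>G\<^esub> j) <#\<^bsub>G\<^esub> H \<in> cosets_within G H A}"

text \<open>The type \<open>'g\<close> bounds the groups that are available. Every finite group has an isomorphic
  copy with carrier in \<^typ>\<open>nat\<close>, so at \<open>'g = nat\<close> every coset space game occurs up to
  isomorphism.\<close>

definition coset_space_game :: "'g set set \<Rightarrow> ('g set \<times> 'g set) set \<Rightarrow> bool" where
  "coset_space_game J \<Gamma> \<longleftrightarrow> game J \<Gamma> \<and>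
     (\<exists>(G :: 'g monoid) H A. group G \<and> finite (carrier G) \<and> odd (order G) \<and>
        subgroup H G \<and> game_subset_for G H A \<and>
        J = lcosets\<^bsub>G\<^esub> H \<and> \<Gamma> = coset_space_relation G H A)"

end

theory Submission
  imports Defs "HOL-Algebra.Weak_Morphisms" "HOL-Algebra.Multiplicative_Group"
begin

text \<open>Left translations act transitively on \<open>G/H\<close> and preserve \<open>\<Gamma>[A/H]\<close>, since
  \<open>(g i)\<inverse> (g j) = i\<inverse> j\<close>. Conversely, let \<open>G\<close> be the automorphism group of a
  point-symmetric game \<open>P\<close> and \<open>H\<close> the stabilizer of a vertex \<open>a\<close>. An involution in \<open>G\<close> would
  swap two vertices, so \<open>G\<close> has odd order. The elements outside \<open>H\<close> split into
  \<open>{g. (a, g a) \<in> P}\<close>, which is a union of double cosets of \<open>H\<close>, and its inverse. Adding one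
  element of each pair \<open>{h, h\<inverse>}\<close> with \<open>h \<in> H - {1}\<close> gives a game subset \<open>A\<close> for
  \<open>(G, H)\<close>, and \<open>g H \<mapsto> g a\<close> identifies \<open>\<Gamma>[A/H]\<close> with \<open>P\<close>.\<close>

section \<open>Involutions, inverse pairs and odd order\<close>

text \<open>An injective labelling of \<open>S\<close> by natural numbers selects from each orbit
  \<open>{x, f x}\<close> the element with the smaller label; the labels differ because
  \<open>f\<close> fixes no point. Applied to inversion, this serves both to count group elements in
  pairs and to choose one element from each inverse pair.\<close>

lemma fixed_point_free_involution_half:
  assumes "finite S" and "\<And>x. x \<in> S \<Longrightarrow> f x \<in> S" and "\<And>x. x \<in> S \<Longrightarrow> f (f x) = x"
    and "\<And>x. x \<in> S \<Longrightarrow> f x \<noteq> x"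
  obtains B where "S = B \<union> f ` B" "B \<inter> f ` B = {}"
proof -
  obtain c :: "'a \<Rightarrow> nat" where c: "inj_on c S"
    using finite_imp_inj_to_nat_seg[OF assms(1)] by blast
  define B where "B = {x \<in> S. c x < c (f x)}"
  have neq: "c (f x) \<noteq> c x" if "x \<in> S" for x
    using c that assms(2,4) by (metis inj_onD)
  have "x \<in> B \<union> f ` B" if x: "x \<in> S" for x
  proof (cases "c x < c (f x)")
    case False
    then have "f x \<in> B"
      using x neq[OF x] assms(2,3) by (simp add: B_def)
    then show ?thesis
      using assms(3)[OF x] by force
  qed (use x in \<open>simp add: B_def\<close>)
  then have "S = B \<union> f ` B"
    using assms(2) by (auto simp: B_def)
  moreover have "B \<inter> f ` B = {}"
    using assms(3) by (auto simp: B_def)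
  ultimately show thesis by (rule that)
qed

text \<open>A self-inverse \<open>x\<close> has order dividing both 2 and the odd group order, hence
  order 1.\<close>

lemma (in group) odd_order_inv_neq:
  assumes "odd (order G)" "x \<in> carrier G" "x \<noteq> \<one>"
  shows "inv x \<noteq> x"
proof
  assume "inv x = x"
  then have "x [^] (2::nat) = \<one>"
    using assms(2) r_inv[of x] by (simp add: numeral_2_eq_2)
  then have "ord x dvd 2"
    using assms(2) by (simp add: pow_eq_id)
  moreover have "ord x dvd order G"
    using assms(2) by (rule ord_dvd_group_order)
  ultimately have "odd (ord x)" "ord x dvd 2"
    using assms(1) dvd_trans by blast+
  then have "ord x = 1"
    using dvd_imp_le[of "ord x" 2] by (auto simp: le_Suc_eq numeral_2_eq_2)
  then show False
    using assms(2,3) ord_eq_1 by blast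
qed

text \<open>Inversion pairs off the non-identity elements, so their number is even, and the identity
  adds one.\<close>

lemma (in group) odd_order_if_no_involutions:
  assumes "finite (carrier G)" "\<And>x. x \<in> carrier G \<Longrightarrow> inv x = x \<Longrightarrow> x = \<one>"
  shows "odd (order G)"
proof -
  let ?S = "carrier G - {\<one>}"
  obtain B where B: "?S = B \<union> m_inv G ` B" "B \<inter> m_inv G ` B = {}"
  proof (rule fixed_point_free_involution_half[of ?S "m_inv G"])
    show "inv x \<noteq> x" if "x \<in> ?S" for x
      using that assms(2)[of x] by blast
  qed (use assms(1) in auto)
  then have sub: "B \<subseteq> carrier G" and fin: "finite B"
    using assms(1) by (auto intro: finite_subset)
  have "inj_on (m_inv G) B"
    using sub inj_on_subset[OF inv_inj] by blast
  then have "card ?S = card B + card B"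
    using B fin by (simp add: card_Un_disjoint card_image)
  moreover have "order G = Suc (card ?S)"
    using assms(1) by (metis card_Suc_Diff1 one_closed order_def)
  ultimately show ?thesis by simp
qed

text \<open>The orbit-stabilizer correspondence in pointwise form: \<open>k\<close> and
  \<open>g\<close> agree on \<open>x\<close> exactly when \<open>inv g \<otimes> k\<close> fixes
  \<open>x\<close>. A coset of the stabilizer is thus determined by the point to which it carries
  \<open>x\<close>.\<close>

lemma (in group_action) stabilizer_l_coset:
  assumes "x \<in> E" "g \<in> carrier G"
  shows "g <# stabilizer G \<phi> x = {k \<in> carrier G. \<phi> k x = \<phi> g x}"
proof -
  interpret G: group G
    using group_hom group_hom.axioms(1) by auto
  have "k \<in> g <# stabilizer G \<phi> x" if k: "k \<in> carrier G" "\<phi> k x = \<phi> g x" for k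
  proof -
    have "\<phi> (inv g) (\<phi> g x) = x"
      using assms orbit_sym_aux by blast
    then have "inv g \<otimes> k \<in> stabilizer G \<phi> x"
      using assms k by (simp add: stabilizer_def composition_rule)
    moreover have "k = g \<otimes> (inv g \<otimes> k)"
      using assms k by (simp flip: G.m_assoc)
    ultimately show ?thesis
      unfolding l_coset_def by blast
  qed
  then show ?thesis
    using assms by (auto simp: l_coset_def stabilizer_def composition_rule)
qed

section \<open>From transitive actions of odd order to coset spaces\<close>

lemma coset_space_relation_subset:
  "coset_space_relation G H A \<subseteq> (lcosets\<^bsub>G\<^esub> H) \<times> (lcosets\<^bsub>G\<^esub> H)"
  by (auto simp: coset_space_relation_def LCOSETS_def)

lemma tournament_iff_not_converse:
  assumes "tournament I P" "i \<in> I" "j \<in> I"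
  shows "(j, i) \<in> P \<longleftrightarrow> (i, j) \<notin> P \<and> i \<noteq> j"
proof -
  have "(i, i) \<notin> P" "i \<noteq> j \<longrightarrow> ((i, j) \<in> P) = ((j, i) \<notin> P)"
    using assms unfolding tournament_def by blast+
  then show ?thesis by auto
qed

text \<open>The acting group is kept abstract, so that the construction applies to any isomorphic
  copy of the automorphism group.\<close>

lemma tournament_transitive_action_coset_space:
  assumes act: "transitive_action G I \<phi>" and fin: "finite (carrier G)" and odd: "odd (order G)"
    and T: "tournament I P" and a: "a \<in> I"
    and inv: "\<And>g i j. g \<in> carrier G \<Longrightarrow> i \<in> I \<Longrightarrow> j \<in> I \<Longrightarrow>
      (\<phi> g i, \<phi> g j) \<in> P \<longleftrightarrow> (i, j) \<in> P"
  defines "H \<equiv> stabilizer G \<phi> a"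
  obtains A where "game_subset_for G H A"
    "tournament_isomorphic I P (lcosets\<^bsub>G\<^esub> H) (coset_space_relation G H A)"
proof -
  interpret transitive_action G I \<phi> by fact
  interpret G: group G
    using group_hom group_hom.axioms(1) by auto
  interpret H: subgroup H G
    unfolding H_def using a by (rule stabilizer_subgroup)
  have closed: "\<phi> g i \<in> I" if "g \<in> carrier G" "i \<in> I" for g i
    using element_image[OF that refl] .
  have H_iff: "g \<in> H \<longleftrightarrow> \<phi> g a = a" if "g \<in> carrier G" for g
    using that unfolding H_def stabilizer_def by blast
  define A0 where "A0 = {g \<in> carrier G. (a, \<phi> g a) \<in> P}"
  \<comment> \<open>All of \<open>H\<close> fixes \<open>a\<close>, so \<open>P\<close> cannot tell
    an element of \<open>H\<close> from its inverse. An arbitrary choice from each inverse pair is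
    made instead; odd order ensures that no pair degenerates.\<close>
  obtain B where B: "H - {\<one>\<^bsub>G\<^esub>} = B \<union> m_inv G ` B" "B \<inter> m_inv G ` B = {}"
  proof (rule fixed_point_free_involution_half[of "H - {\<one>\<^bsub>G\<^esub>}" "m_inv G"])
    show "finite (H - {\<one>\<^bsub>G\<^esub>})"
      using fin H.subset finite_subset by blast
    show "inv\<^bsub>G\<^esub> x \<noteq> x" if "x \<in> H - {\<one>\<^bsub>G\<^esub>}" for x
      using G.odd_order_inv_neq[OF odd] that H.mem_carrier by auto
  qed auto
  have BH: "B \<subseteq> H" "B \<subseteq> carrier G" "\<one>\<^bsub>G\<^esub> \<notin> B" "\<one>\<^bsub>G\<^esub> \<notin> m_inv G ` B" "m_inv G ` B \<subseteq> H"
    using B(1) H.subset by blast+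
  define A where "A = A0 \<union> B"
  have A0_H: "A0 \<inter> H = {}"
    using tournament_iff_not_converse[OF T a a] H_iff by (auto simp: A0_def)
  \<comment> \<open>Applying \<open>g\<close> to the pair from \<open>a\<close> to its image under
    the inverse of \<open>g\<close> gives \<open>(\<phi> g a, a)\<close>, so inverting
    \<open>g\<close> reverses the arrow between \<open>a\<close> and
    \<open>\<phi> g a\<close>.\<close>
  have inv_A0: "inv\<^bsub>G\<^esub> g \<in> A0 \<longleftrightarrow> g \<notin> A0 \<and> g \<notin> H" if g: "g \<in> carrier G" for g
  proof -
    have "(a, \<phi> (inv\<^bsub>G\<^esub> g) a) \<in> P \<longleftrightarrow> (\<phi> g a, \<phi> g (\<phi> (inv\<^bsub>G\<^esub> g) a)) \<in> P"
      using inv[OF g a closed[OF _ a]] g by simp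
    also have "\<phi> g (\<phi> (inv\<^bsub>G\<^esub> g) a) = a"
      using orbit_sym_aux[of "inv\<^bsub>G\<^esub> g" a] g a by simp
    finally have "inv\<^bsub>G\<^esub> g \<in> A0 \<longleftrightarrow> (\<phi> g a, a) \<in> P"
      using g by (simp add: A0_def)
    also have "\<dots> \<longleftrightarrow> (a, \<phi> g a) \<notin> P \<and> \<phi> g a \<noteq> a"
      using tournament_iff_not_converse[OF T a closed[OF g a]] by metis
    finally show ?thesis
      using g H_iff by (auto simp: A0_def)
  qed
  have inv_image: "g \<in> m_inv G ` X \<longleftrightarrow> inv\<^bsub>G\<^esub> g \<in> X" if "g \<in> carrier G" "X \<subseteq> carrier G" for g X
  proof
    assume "inv\<^bsub>G\<^esub> g \<in> X"
    then have "inv\<^bsub>G\<^esub> (inv\<^bsub>G\<^esub> g) \<in> m_inv G ` X" by (rule imageI)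
    then show "g \<in> m_inv G ` X" using that by simp
  qed (use that in auto)
  have set_inv: "set_inv\<^bsub>G\<^esub> X = m_inv G ` X" for X
    by (auto simp: SET_INV_def)
  have A_carrier: "A \<subseteq> carrier G"
    using BH(2) unfolding A_def A0_def by blast
  \<comment> \<open>Inversion preserves \<open>H\<close> and its complement, so the two cases
    separate: inside \<open>H\<close> only \<open>B\<close> matters, outside only
    \<open>A0\<close>.\<close>
  have A_split: "g \<in> A \<longleftrightarrow> inv\<^bsub>G\<^esub> g \<notin> A" if g: "g \<in> carrier G" "g \<noteq> \<one>\<^bsub>G\<^esub>" for g
  proof (cases "g \<in> H")
    case True
    then have "inv\<^bsub>G\<^esub> g \<in> H" by simp
    then have "g \<in> A \<longleftrightarrow> g \<in> B" "inv\<^bsub>G\<^esub> g \<in> A \<longleftrightarrow> inv\<^bsub>G\<^esub> g \<in> B"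
      using True A0_H by (auto simp: A_def)
    moreover have "g \<in> B \<longleftrightarrow> g \<notin> m_inv G ` B"
      using B True g(2) by blast
    ultimately show ?thesis
      using inv_image[OF g(1) BH(2)] by simp
  next
    case False
    then have "inv\<^bsub>G\<^esub> g \<notin> H"
      using g H.m_inv_closed G.inv_inv by metis
    then show ?thesis
      using False BH inv_A0[OF g(1)] by (auto simp: A_def)
  qed
  have one_A: "\<one>\<^bsub>G\<^esub> \<notin> A"
    using A0_H BH H.one_closed by (auto simp: A_def)
  have inv_A: "m_inv G ` A \<subseteq> carrier G" "\<one>\<^bsub>G\<^esub> \<notin> m_inv G ` A"
    using A_carrier inv_image[OF G.one_closed A_carrier] one_A by auto
  have "game_subset G A"
    unfolding game_subset_def set_inv
  proof (intro conjI)
    show "carrier G = A \<union> m_inv G ` A \<union> {\<one>\<^bsub>G\<^esub>}"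
      using A_carrier inv_A A_split inv_image[OF _ A_carrier] by blast
    show "A \<inter> m_inv G ` A = {}"
      using A_carrier one_A A_split inv_image[OF _ A_carrier] by blast
  qed (use one_A inv_A in auto)
  moreover have "H <#>\<^bsub>G\<^esub> (i <#\<^bsub>G\<^esub> H) \<subseteq> A" if i: "i \<in> A - H" for i
  proof
    fix x assume "x \<in> H <#>\<^bsub>G\<^esub> (i <#\<^bsub>G\<^esub> H)"
    then obtain h k where hk: "h \<in> H" "k \<in> H" and x: "x = h \<otimes>\<^bsub>G\<^esub> (i \<otimes>\<^bsub>G\<^esub> k)"
      by (auto simp: set_mult_def l_coset_def)
    \<comment> \<open>Since \<open>B\<close> lies in \<open>H\<close>, the element \<open>i\<close>
      comes from \<open>A0\<close>. The factor \<open>k\<close> fixes \<open>a\<close> and does not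
      change its image under \<open>i\<close>; the factor \<open>h\<close> fixes \<open>a\<close>
      and carries the arrow \<open>(a, \<phi> i a)\<close> to
      \<open>(a, \<phi> x a)\<close>.\<close>
    have i': "i \<in> carrier G" "(a, \<phi> i a) \<in> P"
      using i BH by (auto simp: A_def A0_def)
    have "\<phi> k a = a" "\<phi> h a = a"
      using hk H_iff[OF H.mem_carrier] by blast+
    then have "\<phi> x a = \<phi> h (\<phi> i a)"
      using hk i' a by (simp add: x composition_rule closed)
    then have "(a, \<phi> x a) \<in> P"
      using inv[of h a "\<phi> i a"] i' hk a \<open>\<phi> h a = a\<close> by (simp add: closed)
    then show "x \<in> A"
      using i' hk by (simp add: A_def A0_def x)
  qed
  ultimately have "game_subset_for G H A"
    by (simp add: game_subset_for_def)
  moreover have "tournament_isomorphic I P (lcosets\<^bsub>G\<^esub> H) (coset_space_relation G H A)"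
  proof -
    \<comment> \<open>\<open>\<rho> i\<close> is the fibre over \<open>i\<close> of the map
      \<open>g \<mapsto> \<phi> g a\<close>, that is, the coset belonging to \<open>i\<close>,
      described without choosing a representative. Transitivity makes each fibre nonempty, which
      gives injectivity.\<close>
    define \<rho> where "\<rho> i = {g \<in> carrier G. \<phi> g a = i}" for i
    have coset: "g <#\<^bsub>G\<^esub> H = \<rho> (\<phi> g a)" if "g \<in> carrier G" for g
      using that a by (simp add: H_def \<rho>_def stabilizer_l_coset)
    have inj: "inj_on \<rho> I"
    proof (rule inj_onI)
      fix i j assume "i \<in> I" "j \<in> I" "\<rho> i = \<rho> j"
      moreover obtain g where "g \<in> carrier G" "\<phi> g a = i"
        using unique_orbit a \<open>i \<in> I\<close> by blast
      ultimately show "i = j"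
        by (auto simp: \<rho>_def)
    qed
    have lcosets: "\<rho> ` I = lcosets\<^bsub>G\<^esub> H"
    proof (intro equalityI subsetI)
      fix C assume "C \<in> \<rho> ` I"
      then obtain g where "g \<in> carrier G" "C = \<rho> (\<phi> g a)"
        using unique_orbit[OF a] by blast
      then show "C \<in> lcosets\<^bsub>G\<^esub> H"
        using coset by (auto simp: LCOSETS_def)
    next
      fix C assume "C \<in> lcosets\<^bsub>G\<^esub> H"
      then obtain g where "g \<in> carrier G" "C = \<rho> (\<phi> g a)"
        using coset by (auto simp: LCOSETS_def)
      then show "C \<in> \<rho> ` I"
        using closed a by blast
    qed
    \<comment> \<open>The choice of \<open>B\<close> is invisible on cosets: \<open>H\<close> itself
      contains the identity and so is not inside \<open>A\<close>, while any other coset is a fibre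
      and lies in \<open>A0\<close> as soon as one of its elements does.\<close>
    have coset_A: "g <#\<^bsub>G\<^esub> H \<subseteq> A \<longleftrightarrow> (a, \<phi> g a) \<in> P" if g: "g \<in> carrier G" for g
    proof
      assume sub: "g <#\<^bsub>G\<^esub> H \<subseteq> A"
      have "g \<in> g <#\<^bsub>G\<^esub> H"
        using coset[OF g] g by (simp add: \<rho>_def)
      moreover have "g \<notin> H"
      proof
        assume "g \<in> H"
        then have "\<one>\<^bsub>G\<^esub> \<in> g <#\<^bsub>G\<^esub> H"
          using coset[OF g] H_iff[of g] H_iff[of "\<one>\<^bsub>G\<^esub>"] g by (simp add: \<rho>_def)
        then show False using sub one_A by blast
      qed
      ultimately show "(a, \<phi> g a) \<in> P"
        using sub BH by (auto simp: A_def A0_def)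
    next
      assume "(a, \<phi> g a) \<in> P"
      then show "g <#\<^bsub>G\<^esub> H \<subseteq> A"
        using coset[OF g] by (auto simp: \<rho>_def A_def A0_def)
    qed
    \<comment> \<open>This holds for every choice of representatives, since translation by
      \<open>g\<close> carries the arrow from \<open>a\<close> to the arrow from
      \<open>\<phi> g a\<close> to \<open>\<phi> k a\<close>.\<close>
    have diff: "inv\<^bsub>G\<^esub> g \<otimes>\<^bsub>G\<^esub> k <#\<^bsub>G\<^esub> H \<in> cosets_within G H A \<longleftrightarrow> (\<phi> g a, \<phi> k a) \<in> P"
      if gk: "g \<in> carrier G" "k \<in> carrier G" for g k
    proof -
      have "inv\<^bsub>G\<^esub> g \<otimes>\<^bsub>G\<^esub> k <#\<^bsub>G\<^esub> H \<in> cosets_within G H A \<longleftrightarrow> inv\<^bsub>G\<^esub> g \<otimes>\<^bsub>G\<^esub> k <#\<^bsub>G\<^esub> H \<subseteq> A"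
        using gk by (auto simp: cosets_within_def)
      also have "\<dots> \<longleftrightarrow> (a, \<phi> (inv\<^bsub>G\<^esub> g \<otimes>\<^bsub>G\<^esub> k) a) \<in> P"
        using gk by (simp add: coset_A)
      also have "\<dots> \<longleftrightarrow> (\<phi> g a, \<phi> g (\<phi> (inv\<^bsub>G\<^esub> g \<otimes>\<^bsub>G\<^esub> k) a)) \<in> P"
        using inv[OF gk(1) a closed[OF _ a]] gk by simp
      also have "\<phi> g (\<phi> (inv\<^bsub>G\<^esub> g \<otimes>\<^bsub>G\<^esub> k) a) = \<phi> k a"
        using gk a by (simp flip: composition_rule G.m_assoc)
      finally show ?thesis .
    qed
    have "(i, j) \<in> P \<longleftrightarrow> (\<rho> i, \<rho> j) \<in> coset_space_relation G H A" if ij: "i \<in> I" "j \<in> I" for i j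
    proof
      assume P: "(i, j) \<in> P"
      obtain g k where gk: "g \<in> carrier G" "k \<in> carrier G" "\<phi> g a = i" "\<phi> k a = j"
        using unique_orbit a ij by metis
      then have "\<rho> i = g <#\<^bsub>G\<^esub> H" "\<rho> j = k <#\<^bsub>G\<^esub> H"
        using coset by auto
      moreover have "inv\<^bsub>G\<^esub> g \<otimes>\<^bsub>G\<^esub> k <#\<^bsub>G\<^esub> H \<in> cosets_within G H A"
        using diff gk P by simp
      ultimately show "(\<rho> i, \<rho> j) \<in> coset_space_relation G H A"
        unfolding coset_space_relation_def using gk(1,2) by blast
    next
      \<comment> \<open>The relation supplies some representatives of the two cosets; injectivity of
        \<open>\<rho>\<close> shows that they carry \<open>a\<close> to \<open>i\<close> and
        \<open>j\<close>.\<close>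
      assume "(\<rho> i, \<rho> j) \<in> coset_space_relation G H A"
      then obtain g k where gk: "g \<in> carrier G" "k \<in> carrier G" and
        eq: "\<rho> i = \<rho> (\<phi> g a)" "\<rho> j = \<rho> (\<phi> k a)" and P: "(\<phi> g a, \<phi> k a) \<in> P"
        using diff coset by (auto simp: coset_space_relation_def)
      have "i = \<phi> g a" "j = \<phi> k a"
        using eq inj ij gk closed[OF _ a] by (auto dest: inj_onD)
      then show "(i, j) \<in> P" using P by simp
    qed
    then show ?thesis
      using inj lcosets
      by (auto simp: tournament_isomorphic_def tournament_isomorphism_def bij_betw_def)
  qed
  ultimately show thesis by (rule that)
qed

text \<open>Transport of structure. An isomorphism constrains \<open>\<Gamma>\<close> only on
  \<open>J\<close>, whereas the neighbour sets in \<open>game\<close> range over the whole type; the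
  inclusion \<open>sub\<close> bridges this gap.\<close>

lemma game_isomorphic:
  assumes game: "game I P" and iso: "tournament_isomorphic I P J \<Gamma>" and sub: "\<Gamma> \<subseteq> J \<times> J"
  shows "game J \<Gamma>"
proof -
  obtain \<rho> where bij: "bij_betw \<rho> I J"
    and rel: "\<And>i j. i \<in> I \<Longrightarrow> j \<in> I \<Longrightarrow> (i, j) \<in> P \<longleftrightarrow> (\<rho> i, \<rho> j) \<in> \<Gamma>"
    using iso unfolding tournament_isomorphic_def tournament_isomorphism_def by blast
  have P: "P \<subseteq> I \<times> I" and T: "tournament I P"
    using game unfolding game_def tournament_def by blast+
  have J: "J = \<rho> ` I" and inj: "inj_on \<rho> I"
    using bij by (auto simp: bij_betw_def)
  have card: "card {y. (\<rho> i, y) \<in> \<Gamma>} = card {j. (i, j) \<in> P}"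
    "card {y. (y, \<rho> i) \<in> \<Gamma>} = card {j. (j, i) \<in> P}" if i: "i \<in> I" for i
  proof -
    have "{y. (\<rho> i, y) \<in> \<Gamma>} = \<rho> ` {j. (i, j) \<in> P}" "{y. (y, \<rho> i) \<in> \<Gamma>} = \<rho> ` {j. (j, i) \<in> P}"
      using sub P rel i by (auto simp: J)
    moreover have "inj_on \<rho> {j. (i, j) \<in> P}" "inj_on \<rho> {j. (j, i) \<in> P}"
      using P by (auto intro: inj_on_subset[OF inj])
    ultimately show "card {y. (\<rho> i, y) \<in> \<Gamma>} = card {j. (i, j) \<in> P}"
      "card {y. (y, \<rho> i) \<in> \<Gamma>} = card {j. (j, i) \<in> P}"
      by (simp_all add: card_image)
  qed
  have "tournament J \<Gamma>"
    unfolding tournament_def J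
  proof (intro conjI ballI impI)
    show "finite (\<rho> ` I)"
      using T by (simp add: tournament_def)
    show "\<Gamma> \<subseteq> \<rho> ` I \<times> \<rho> ` I"
      using sub by (simp add: J)
    fix x assume "x \<in> \<rho> ` I"
    then obtain i where i: "i \<in> I" "x = \<rho> i" by blast
    then show "(x, x) \<notin> \<Gamma>"
      using tournament_iff_not_converse[OF T, of i i] rel[of i i] by blast
    fix y assume "y \<in> \<rho> ` I" "x \<noteq> y"
    then obtain j where j: "j \<in> I" "y = \<rho> j" "i \<noteq> j"
      using i by blast
    then show "(x, y) \<in> \<Gamma> \<longleftrightarrow> (y, x) \<notin> \<Gamma>"
      using tournament_iff_not_converse[OF T, of i j] rel[of i j] rel[of j i] i by blast
  qed
  moreover have "card J = card I"
    using bij by (simp add: bij_betw_same_card)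
  ultimately show ?thesis
    using game card by (auto simp: game_def J)
qed

section \<open>The automorphism group of a tournament\<close>

lemma automorphism_group_memD:
  assumes "\<rho> \<in> carrier (automorphism_group I P)"
  shows "\<rho> \<in> extensional I" "bij_betw \<rho> I I"
    "i \<in> I \<Longrightarrow> j \<in> I \<Longrightarrow> (\<rho> i, \<rho> j) \<in> P \<longleftrightarrow> (i, j) \<in> P"
  using assms by (auto simp: automorphism_group_def tournament_isomorphism_def)

lemma group_automorphism_group: "group (automorphism_group I P)"
  using group_action_automorphism_group[of I P]
  by (simp add: group_action_def group_hom.axioms(1))

text \<open>Extensionality places the automorphisms in the finite function space on
  \<open>I\<close>.\<close>

lemma finite_automorphism_group:
  assumes "finite I"
  shows "finite (carrier (automorphism_group I P))"
proof (rule finite_subset)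
  show "carrier (automorphism_group I P) \<subseteq> (I \<rightarrow>\<^sub>E I)"
    by (auto simp: PiE_def dest: automorphism_group_memD(1,2) bij_betw_imp_funcset)
  show "finite (I \<rightarrow>\<^sub>E I)"
    using assms by (simp add: finite_PiE)
qed

text \<open>A self-inverse automorphism moving \<open>i\<close> would exchange \<open>i\<close> and
  \<open>\<rho> i\<close>, reversing the only arrow between them.\<close>

lemma odd_order_automorphism_group:
  assumes T: "tournament I P"
  shows "odd (order (automorphism_group I P))"
proof -
  let ?G = "automorphism_group I P"
  interpret G: group ?G by (rule group_automorphism_group)
  interpret group_action ?G I "\<lambda>\<rho>. \<rho>" by (rule group_action_automorphism_group)
  show ?thesis
  proof (rule G.odd_order_if_no_involutions)
    show "finite (carrier ?G)"
      using T by (intro finite_automorphism_group) (simp add: tournament_def)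
  next
    fix \<rho> assume \<rho>: "\<rho> \<in> carrier ?G" and inv: "inv\<^bsub>?G\<^esub> \<rho> = \<rho>"
    have "\<rho> i = i" if i: "i \<in> I" for i
    proof (rule ccontr)
      assume neq: "\<rho> i \<noteq> i"
      have mem: "\<rho> i \<in> I"
        using element_image[OF \<rho> i] by simp
      have "\<rho> (\<rho> i) = i"
        using orbit_sym_aux[OF \<rho> i refl] inv by simp
      then have "(\<rho> i, i) \<in> P \<longleftrightarrow> (i, \<rho> i) \<in> P"
        using automorphism_group_memD(3)[OF \<rho> i mem] by simp
      then show False
        using tournament_iff_not_converse[OF T i mem] neq by simp
    qed
    then have "\<rho> = (\<lambda>x\<in>I. x)"
      using automorphism_group_memD(1)[OF \<rho>] by (auto simp: extensional_def)
    then show "\<rho> = \<one>\<^bsub>?G\<^esub>"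
      using id_eq_one by simp
  qed
qed

text \<open>The automorphism group lives in a function type, so it is replaced by a copy on
  natural numbers.\<close>

lemma point_symmetric_imp_coset_space_game:
  assumes game: "game I P" and sym: "point_symmetric I P"
  shows "\<exists>(J :: nat set set) \<Gamma>. coset_space_game J \<Gamma> \<and> tournament_isomorphic I P J \<Gamma>"
proof -
  let ?G = "automorphism_group I P"
  interpret G: group ?G by (rule group_automorphism_group)
  interpret act: transitive_action ?G I "\<lambda>\<rho>. \<rho>"
    using sym by (simp add: point_symmetric_def)
  have T: "tournament I P" and "I \<noteq> {}"
    using game by (auto simp: game_def)
  then obtain a where a: "a \<in> I" by blast
  have finG: "finite (carrier ?G)"
    using T by (intro finite_automorphism_group) (simp add: tournament_def)
  obtain c :: "('a \<Rightarrow> 'a) \<Rightarrow> nat" where c: "inj_on c (carrier ?G)"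
    using finite_imp_inj_to_nat_seg[OF finG] by blast
  define N where "N = image_group c ?G"
  have iso: "c \<in> iso ?G N"
    unfolding N_def by (rule inj_imp_image_group_iso[OF c])
  have "group N"
    unfolding N_def by (rule G.inj_imp_image_group_is_group[OF c])
  then interpret N: group N .
  \<comment> \<open>\<open>\<phi>\<close> decodes a number into the automorphism it stands for.
    Being a homomorphism onto the automorphism group, it yields an action of \<open>N\<close> on
    \<open>I\<close> that inherits transitivity.\<close>
  define \<phi> where "\<phi> = inv_into (carrier ?G) c"
  have \<phi>: "\<phi> \<in> iso N ?G"
    unfolding \<phi>_def by (rule G.iso_set_sym[OF iso])
  then have \<phi>_img: "\<phi> ` carrier N = carrier ?G" and \<phi>_hom: "\<phi> \<in> hom N ?G"
    by (auto simp: iso_def bij_betw_def)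
  have finN: "finite (carrier N)" and "order N = order ?G"
    using iso finG by (auto simp: iso_def order_def bij_betw_finite bij_betw_same_card)
  then have oddN: "odd (order N)"
    using odd_order_automorphism_group[OF T] by simp
  have "(\<lambda>\<rho>. \<rho>) \<in> hom ?G (BijGroup I)"
    using act.group_hom by (simp add: group_hom_def group_hom_axioms_def)
  then have "\<phi> \<in> hom N (BijGroup I)"
    using hom_compose[OF \<phi>_hom] by (simp add: comp_def)
  then have act_N: "group_action N I \<phi>"
    using N.group_axioms group_BijGroup
    by (simp add: group_action_def group_hom_def group_hom_axioms_def)
  have "\<exists>g\<in>carrier N. \<phi> g x = y" if "x \<in> I" "y \<in> I" for x y
    using act.unique_orbit[OF that] unfolding \<phi>_img[symmetric] by blast
  then have trans: "transitive_action N I \<phi>"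
    using act_N by (simp add: transitive_action_def transitive_action_axioms_def)
  obtain A where A: "game_subset_for N (stabilizer N \<phi> a) A"
    and isoA: "tournament_isomorphic I P (lcosets\<^bsub>N\<^esub> (stabilizer N \<phi> a))
      (coset_space_relation N (stabilizer N \<phi> a) A)"
  proof (rule tournament_transitive_action_coset_space[OF trans finN oddN T a])
    fix g i j assume "g \<in> carrier N" "i \<in> I" "j \<in> I"
    then show "(\<phi> g i, \<phi> g j) \<in> P \<longleftrightarrow> (i, j) \<in> P"
      using \<phi>_img by (intro automorphism_group_memD(3)) auto
  qed
  have "subgroup (stabilizer N \<phi> a) N"
    using act_N a by (rule group_action.stabilizer_subgroup)
  then have "coset_space_game (lcosets\<^bsub>N\<^esub> (stabilizer N \<phi> a))
      (coset_space_relation N (stabilizer N \<phi> a) A)"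
    \<comment> \<open>That the coset space carries a game is obtained by transport from
      \<open>P\<close>.\<close>
    using game_isomorphic[OF game isoA coset_space_relation_subset] N.group_axioms finN oddN A
    unfolding coset_space_game_def by blast
  then show ?thesis
    using isoA by blast
qed

section \<open>Point symmetry of coset space games\<close>

text \<open>Only preservation of the relation is computed; translation by \<open>inv g\<close>
  provides both the inverse map and the reverse implication.\<close>

lemma (in group) l_translation_coset_space:
  assumes H: "subgroup H G" and g: "g \<in> carrier G"
  shows "tournament_isomorphism (lcosets H) (coset_space_relation G H A)
    (lcosets H) (coset_space_relation G H A) (\<lambda>C. g <# C)"
proof -
  let ?\<Gamma> = "coset_space_relation G H A"
  have sub: "H \<subseteq> carrier G"
    using H by (rule subgroup.subset)
  have shift: "k <# (i <# H) = (k \<otimes> i) <# H" if "k \<in> carrier G" "i \<in> carrier G" for k i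
    using that sub by (simp add: lcos_m_assoc)
  have closed: "k <# C \<in> lcosets H" if "k \<in> carrier G" "C \<in> lcosets H" for k C
    using that shift by (auto simp: LCOSETS_def)
  have cancel: "inv k <# (k <# C) = C" "k <# (inv k <# C) = C"
    if "k \<in> carrier G" "C \<in> lcosets H" for k C
    using that sub lcosets_subset_PowG[OF H] by (auto simp: lcos_m_assoc lcos_mult_one)
  have imp: "(k <# C, k <# D) \<in> ?\<Gamma>" if k: "k \<in> carrier G" and CD: "(C, D) \<in> ?\<Gamma>" for k C D
  proof -
    obtain i j where ij: "i \<in> carrier G" "j \<in> carrier G" "C = i <# H" "D = j <# H"
      "(inv i \<otimes> j) <# H \<in> cosets_within G H A"
      using CD by (auto simp: coset_space_relation_def)
    have "inv (k \<otimes> i) \<otimes> (k \<otimes> j) = inv i \<otimes> j"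
      using k ij by (simp add: inv_mult_group m_assoc) (simp flip: m_assoc)
    then show ?thesis
      unfolding coset_space_relation_def using k ij shift by fastforce
  qed
  have "bij_betw (\<lambda>C. g <# C) (lcosets H) (lcosets H)"
    by (rule bij_betw_byWitness[where f' = "\<lambda>C. inv g <# C"]) (use g closed cancel in auto)
  moreover have "(C, D) \<in> ?\<Gamma> \<longleftrightarrow> (g <# C, g <# D) \<in> ?\<Gamma>"
    if "C \<in> lcosets H" "D \<in> lcosets H" for C D
    using imp[OF g, of C D] imp[of "inv g" "g <# C" "g <# D"] g cancel(1) that by auto
  ultimately show ?thesis
    by (simp add: tournament_isomorphism_def)
qed

text \<open>Restricting to \<open>I\<close> makes any isomorphism extensional, so composites can be
  used directly as witnesses of transitivity.\<close>

lemma point_symmetricI: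
  assumes "\<And>i j. i \<in> I \<Longrightarrow> j \<in> I \<Longrightarrow> \<exists>\<rho>. tournament_isomorphism I P I P \<rho> \<and> \<rho> i = j"
  shows "point_symmetric I P"
  unfolding point_symmetric_def transitive_action_def transitive_action_axioms_def
proof (intro conjI group_action_automorphism_group allI impI)
  fix i j assume ij: "i \<in> I" "j \<in> I"
  then obtain \<rho> where \<rho>: "tournament_isomorphism I P I P \<rho>" "\<rho> i = j"
    using assms by blast
  then have "restrict \<rho> I \<in> carrier (automorphism_group I P)"
    by (auto simp: automorphism_group_def tournament_isomorphism_def)
  moreover have "restrict \<rho> I i = j"
    using \<rho> ij by simp
  ultimately show "\<exists>\<sigma>\<in>carrier (automorphism_group I P). \<sigma> i = j" by blast
qed

lemma tournament_isomorphism_sym: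
  assumes "tournament_isomorphism I P J \<Gamma> \<rho>"
  shows "tournament_isomorphism J \<Gamma> I P (inv_into I \<rho>)"
proof -
  have bij: "bij_betw \<rho> I J"
    using assms by (simp add: tournament_isomorphism_def)
  then have "\<rho> (inv_into I \<rho> x) = x" "inv_into I \<rho> x \<in> I" if "x \<in> J" for x
    using that by (auto simp: bij_betw_inv_into_right bij_betw_def inv_into_into)
  then show ?thesis
    using assms bij_betw_inv_into[OF bij] by (auto simp: tournament_isomorphism_def)
qed

lemma tournament_isomorphism_comp:
  assumes "tournament_isomorphism I P J \<Gamma> \<rho>" "tournament_isomorphism J \<Gamma> K \<Delta> \<sigma>"
  shows "tournament_isomorphism I P K \<Delta> (\<sigma> \<circ> \<rho>)"
  using assms bij_betw_trans[of \<rho> I J \<sigma> K] bij_betwE[of \<rho> I J]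
  by (auto simp: tournament_isomorphism_def)

lemma isomorphic_coset_space_game_imp_point_symmetric:
  fixes J :: "'g set set"
  assumes "coset_space_game J \<Gamma>" and "tournament_isomorphic I P J \<Gamma>"
  shows "point_symmetric I P"
proof (rule point_symmetricI)
  fix i j assume ij: "i \<in> I" "j \<in> I"
  obtain G :: "'g monoid" and H A where "group G" and H: "subgroup H G"
    and J: "J = lcosets\<^bsub>G\<^esub> H" and \<Gamma>: "\<Gamma> = coset_space_relation G H A"
    using assms(1) unfolding coset_space_game_def by blast
  interpret group G by fact
  obtain \<rho> where \<rho>: "tournament_isomorphism I P J \<Gamma> \<rho>"
    using assms(2) by (auto simp: tournament_isomorphic_def)
  then have bij: "bij_betw \<rho> I J"
    by (simp add: tournament_isomorphism_def)
  then have "\<rho> i \<in> J" "\<rho> j \<in> J"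
    using ij bij_betwE by auto
  then obtain g k where gk: "g \<in> carrier G" "k \<in> carrier G" "\<rho> i = g <#\<^bsub>G\<^esub> H" "\<rho> j = k <#\<^bsub>G\<^esub> H"
    by (auto simp: J LCOSETS_def)
  \<comment> \<open>Left translation by \<open>k\<close> times the inverse of \<open>g\<close> takes
    the coset of \<open>g\<close> to that of \<open>k\<close>; conjugation by \<open>\<rho>\<close>
    turns it into an automorphism of \<open>P\<close> taking \<open>i\<close> to
    \<open>j\<close>.\<close>
  define \<tau> where "\<tau> C = (k \<otimes>\<^bsub>G\<^esub> inv\<^bsub>G\<^esub> g) <#\<^bsub>G\<^esub> C" for C
  have "\<tau> (\<rho> i) = \<rho> j"
    using gk subgroup.subset[OF H] by (simp add: \<tau>_def lcos_m_assoc m_assoc)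
  then have "(inv_into I \<rho> \<circ> (\<tau> \<circ> \<rho>)) i = j"
    using bij ij by (simp add: bij_betw_inv_into_left)
  moreover have "tournament_isomorphism J \<Gamma> J \<Gamma> \<tau>"
    unfolding J \<Gamma> \<tau>_def using H gk by (intro l_translation_coset_space) auto
  then have "tournament_isomorphism I P I P (inv_into I \<rho> \<circ> (\<tau> \<circ> \<rho>))"
    using \<rho> by (blast intro: tournament_isomorphism_comp tournament_isomorphism_sym)
  ultimately show "\<exists>\<sigma>. tournament_isomorphism I P I P \<sigma> \<and> \<sigma> i = j" by blast
qed

text \<open>The existential needs a fixed type, and \<open>nat\<close> accommodates a copy of the
  finite automorphism group. The second conjunct gives the converse direction for groups over an
  arbitrary type \<open>'g\<close>.\<close>

theorem corollary9p10:
  fixes I :: "'a set" and P :: "('a \<times> 'a) set"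
  assumes "game I P"
  shows "(point_symmetric I P \<longleftrightarrow>
            (\<exists>(J :: nat set set) \<Gamma>. coset_space_game J \<Gamma> \<and> tournament_isomorphic I P J \<Gamma>)) \<and>
         (\<forall>(J :: 'g set set) \<Gamma>.
            coset_space_game J \<Gamma> \<and> tournament_isomorphic I P J \<Gamma> \<longrightarrow> point_symmetric I P)"
  using assms point_symmetric_imp_coset_space_game
  by (blast intro: isomorphic_coset_space_game_imp_point_symmetric)

end
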